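(* Let $X$ be a regular, locally CCC, locally Baire space. If $X$ has a sharp base, then $X$ is metrizable.
   Context: All spaces are $T_1$ topological spaces (so regular spaces are $T_1$); $\omega=\{0,1,2,\dots\}$. A base $\mathcal{B}$ for a space $X$ is sharp if, whenever $x\in X$ and $(B_n)_{n\in\omega}$ is a sequence of pairwise distinct elements of $\mathcal{B}$ each containing $x$, the collection $\{\bigcap_{j\le n}B_j:n\in\omega\}$ is a local base at $x$. A space is CCC if every pairwise disjoint family of nonempty open sets is countable, and is Baire if every intersection of countably many dense open sets is dense. A space is locally CCC (respectively locally Baire) if every point has a neighbourhood which, as a subspace, is CCC (respectively Baire). *)

theory Defs
  imports "HOL-Analysis.Analysis"
begin

definition base_of :: "'a topology \<Rightarrow> 'a set set \<Rightarrow> bool" where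
  "base_of X \<B> \<longleftrightarrow> openin X = arbitrary union_of (\<lambda>B. B \<in> \<B>)"

definition local_base_at :: "'a topology \<Rightarrow> 'a \<Rightarrow> 'a set set \<Rightarrow> bool" where
  "local_base_at X x \<L> \<longleftrightarrow>
     (\<forall>V\<in>\<L>. openin X V \<and> x \<in> V) \<and>
     (\<forall>U. openin X U \<and> x \<in> U \<longrightarrow> (\<exists>V\<in>\<L>. V \<subseteq> U))"

definition sharp_base :: "'a topology \<Rightarrow> 'a set set \<Rightarrow> bool" where
  "sharp_base X \<B> \<longleftrightarrow>
     base_of X \<B> \<and>
     (\<forall>x\<in>topspace X. \<forall>B :: nat \<Rightarrow> 'a set.
        inj B \<and> (\<forall>n. B n \<in> \<B> \<and> x \<in> B n) \<longrightarrow>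
        local_base_at X x (range (\<lambda>n. \<Inter>j\<le>n. B j)))"

definition ccc_space :: "'a topology \<Rightarrow> bool" where
  "ccc_space X \<longleftrightarrow>
     (\<forall>\<U>. (\<forall>U\<in>\<U>. openin X U \<and> U \<noteq> {}) \<and> pairwise disjnt \<U> \<longrightarrow> countable \<U>)"

(* Intersecting with topspace X only matters for the empty family, whose
   intersection is to be read as the whole space. *)
definition Baire_space :: "'a topology \<Rightarrow> bool" where
  "Baire_space X \<longleftrightarrow>
     (\<forall>\<G>. countable \<G> \<and> (\<forall>G\<in>\<G>. openin X G \<and> X closure_of G = topspace X) \<longrightarrow>
        X closure_of (topspace X \<inter> \<Inter>\<G>) = topspace X)"

(* Every point has some neighbourhood, not necessarily open, with the property;
   unlike neighbourhood_base_of, arbitrarily small ones are not required. *)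
definition locally_space :: "('a topology \<Rightarrow> bool) \<Rightarrow> 'a topology \<Rightarrow> bool" where
  "locally_space P X \<longleftrightarrow>
     (\<forall>x\<in>topspace X. \<exists>U N. openin X U \<and> x \<in> U \<and> U \<subseteq> N \<and> N \<subseteq> topspace X \<and>
        P (subtopology X N))"

end

theory Submission
  imports Defs
begin

text \<open>
  The proof has a local and a global half.

  Locally, the space is separable.  In an open set that is CCC and Baire, choose a sequence of
  disjoint families of base elements, each family a maximal disjoint family of proper subsets of
  the previous one.  The families are countable by CCC, and up to isolated points their unions are
  dense and open.  By the Baire property densely many points \<open>x\<close> lie in a member of every family or
  are isolated.  In the former case these members form a strictly decreasing sequence, which
  sharpness turns into a local base at \<open>x\<close>.  One point from every chosen set, together with the
  isolated points, is therefore a countable dense set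
  (\<open>separable_if_ccc_Baire_sharp_base\<close>).

  A sharp base of a T1 space has only finitely many elements through any two points
  (\<open>sharp_base_finite_two_points\<close>), for infinitely many such elements would give a local base at one
  point that never separates it from the other.  Hence open separable subspaces are second
  countable, and metrizable by Urysohn's theorem.

  Globally, the space has to be cut into disjoint open separable pieces.  This is easy when a cover
  by open separable sets is point-countable: such sets meet only countably many others, so chains
  of overlapping sets form countable classes with disjoint unions
  (\<open>partition_of_point_countable_cover\<close>).  The family \<open>\<F>\<close> of separable base elements covers the
  space.  A non-isolated point lies in only countably many members of \<open>\<F>\<close>: each of them contains a
  second point of one fixed countable dense set.  An isolated point may lie in uncountably many,
  and is to be removed from most of them.

  Such a removal exists by a transfinite argument on the cardinality of subfamilies
  (\<open>shrink_to_point_countable\<close>).  Fix a countable dense subset of every member of \<open>\<F>\<close>.  Call a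
  subfamily closed if it contains every member of \<open>\<F>\<close> that passes through two points of the
  dense sets of its members.  As only finitely many members pass through any two points, every
  infinite family has a closed superfamily of the same cardinality.  A member of \<open>\<F>\<close> outside a
  closed subfamily meets the union of that subfamily in at most one point, which is then isolated
  (\<open>trace_on_closed_family\<close>).  An uncountable family is exhausted by a well-ordered increasing
  chain of closed families of smaller cardinality.  By induction each layer of the chain has a
  point-countable shrinking; removing from every set of a layer the at most one point that it
  shares with the earlier layers makes the layers disjoint from each other, so that the shrinkings
  together remain point-countable.
\<close>

section \<open>Bases\<close>

lemma base_of_openin:
  assumes "base_of X \<B>" "B \<in> \<B>"
  shows "openin X B"
  using assms unfolding base_of_def openin_topology_base_unique by blast

lemma base_of_refine:
  assumes "base_of X \<B>" "openin X U" "x \<in> U"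
  obtains B where "B \<in> \<B>" "x \<in> B" "B \<subseteq> U"
  using assms unfolding base_of_def openin_topology_base_unique by blast

lemma sharp_base_imp_base_of: "sharp_base X \<B> \<Longrightarrow> base_of X \<B>"
  by (simp add: sharp_base_def)

text \<open>
  Infinitely many base elements through \<open>x\<close> and \<open>y\<close> would yield a local base at \<open>x\<close> all of whose
  members contain \<open>y\<close>, against T1.
\<close>
lemma sharp_base_finite_two_points:
  assumes "t1_space X" "sharp_base X \<B>" "x \<in> topspace X" "x \<noteq> y"
  shows "finite {B \<in> \<B>. x \<in> B \<and> y \<in> B}"
proof (rule ccontr)
  assume "infinite {B \<in> \<B>. x \<in> B \<and> y \<in> B}"
  then obtain B :: "nat \<Rightarrow> 'a set" where "inj B" and B: "range B \<subseteq> {B \<in> \<B>. x \<in> B \<and> y \<in> B}"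
    by (meson infinite_countable_subset)
  then have "local_base_at X x (range (\<lambda>n. \<Inter>j\<le>n. B j))"
    using assms(2,3) unfolding sharp_base_def by blast
  moreover have "openin X (topspace X - {y})"
    by (metis assms(1) Diff_empty Diff_insert0 closedin_def closedin_t1_singleton openin_topspace)
  ultimately obtain n where "(\<Inter>j\<le>n. B j) \<subseteq> topspace X - {y}"
    using assms(3,4) unfolding local_base_at_def by blast
  moreover have "y \<in> (\<Inter>j\<le>n. B j)"
    using B by blast
  ultimately show False by blast
qed

lemma openin_Diff_singleton:
  assumes "t1_space X" "openin X U"
  shows "openin X (U - {y})"
  by (metis Diff_empty Diff_insert0 assms closedin_t1_singleton openin_diff openin_subset subsetD)

section \<open>Separable open subspaces\<close>

text \<open>
  For an open set \<open>U\<close>, density inside the subspace can be tested with the open sets of the whole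
  space.
\<close>
lemma separable_subtopology_iff:
  assumes "openin X U"
  shows "separable_space (subtopology X U) \<longleftrightarrow>
    (\<exists>C. countable C \<and> C \<subseteq> U \<and> (\<forall>V. openin X V \<and> V \<inter> U \<noteq> {} \<longrightarrow> V \<inter> C \<noteq> {}))"
proof -
  have U: "U \<subseteq> topspace X"
    using assms openin_subset by blast
  have "subtopology X U closure_of C = U \<longleftrightarrow>
      (\<forall>V. openin X V \<and> V \<inter> U \<noteq> {} \<longrightarrow> V \<inter> C \<noteq> {})" if C: "C \<subseteq> U" for C
  proof -
    have "subtopology X U closure_of C = U \<longleftrightarrow> U \<subseteq> X closure_of C"
      using closure_of_subtopology_subset[of X U C] assms C
      by (auto simp: closure_of_subtopology_open)
    also have "\<dots> \<longleftrightarrow> (\<forall>V. openin X V \<and> V \<inter> U \<noteq> {} \<longrightarrow> V \<inter> C \<noteq> {})"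
      using U unfolding closure_of_def by blast
    finally show ?thesis .
  qed
  then show ?thesis
    using U unfolding separable_space_def by (metis topspace_subtopology_subset)
qed

lemma separable_subtopology_subset:
  assumes "separable_space (subtopology X U)" "openin X V" "V \<subseteq> U"
  shows "separable_space (subtopology X V)"
proof -
  have "openin (subtopology X U) V"
    using assms(2,3) by (metis inf.orderE openin_subtopology)
  then show ?thesis
    using separable_space_open_subset[OF assms(1), of V] assms(3)
    by (simp add: subtopology_subtopology inf.absorb2)
qed

lemma separable_subtopology_Union:
  assumes "countable \<U>" and "\<And>U. U \<in> \<U> \<Longrightarrow> openin X U \<and> separable_space (subtopology X U)"
  shows "separable_space (subtopology X (\<Union>\<U>))"
proof -
  have "\<forall>U\<in>\<U>. \<exists>C. countable C \<and> C \<subseteq> U \<and> (\<forall>V. openin X V \<and> V \<inter> U \<noteq> {} \<longrightarrow> V \<inter> C \<noteq> {})"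
    using assms(2) separable_subtopology_iff by blast
  then obtain C where C: "\<forall>U\<in>\<U>. countable (C U) \<and> C U \<subseteq> U \<and>
        (\<forall>V. openin X V \<and> V \<inter> U \<noteq> {} \<longrightarrow> V \<inter> C U \<noteq> {})"
    by metis
  have "openin X (\<Union>\<U>)"
    using assms(2) by blast
  moreover have "countable (\<Union>U\<in>\<U>. C U)"
    using assms(1) C by blast
  moreover have "(\<Union>U\<in>\<U>. C U) \<subseteq> \<Union>\<U>"
    using C by blast
  moreover have "V \<inter> (\<Union>U\<in>\<U>. C U) \<noteq> {}" if V: "openin X V" "V \<inter> \<Union>\<U> \<noteq> {}" for V
  proof -
    obtain U where "U \<in> \<U>" "V \<inter> U \<noteq> {}"
      using V by blast
    then have "V \<inter> C U \<noteq> {}"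
      using C V(1) by simp
    with \<open>U \<in> \<U>\<close> show ?thesis
      by blast
  qed
  ultimately show ?thesis
    unfolding separable_subtopology_iff[OF \<open>openin X (\<Union>\<U>)\<close>]
    by (intro exI[of _ "\<Union>U\<in>\<U>. C U"]) simp
qed

text \<open>
  A base element with at least two points contains two points of a given countable dense set, and
  each of the countably many pairs of such points lies in only finitely many base elements.
\<close>
lemma separable_imp_second_countable_sharp_base:
  assumes t1: "t1_space X" and sb: "sharp_base X \<B>"
    and W: "openin X W" and sep: "separable_space (subtopology X W)"
  shows "second_countable (subtopology X W)"
proof -
  note base = sharp_base_imp_base_of[OF sb]
  obtain C where C: "countable C" "C \<subseteq> W"
    and dense: "\<And>V. openin X V \<Longrightarrow> V \<inter> W \<noteq> {} \<Longrightarrow> V \<inter> C \<noteq> {}"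
    using sep separable_subtopology_iff[OF W] by metis
  define \<B>W where "\<B>W = {B \<in> \<B>. B \<subseteq> W}"
  define \<D> where "\<D> = insert {} ((\<lambda>d. {d}) ` C) \<union>
      (\<Union>p\<in>C. \<Union>q\<in>C - {p}. {B \<in> \<B>. p \<in> B \<and> q \<in> B})"
  have "countable {B \<in> \<B>. p \<in> B \<and> q \<in> B}" if "p \<in> C" "q \<in> C - {p}" for p q
  proof -
    have "p \<in> topspace X" "p \<noteq> q"
      using that C(2) openin_subset[OF W] by auto
    then show ?thesis
      by (intro countable_finite sharp_base_finite_two_points[OF t1 sb])
  qed
  then have "countable \<D>"
    unfolding \<D>_def using C(1) by (intro countable_Un countable_insert countable_UN) auto
  moreover have "\<B>W \<subseteq> \<D>"
  proof
    fix B assume "B \<in> \<B>W"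
    then have B: "B \<in> \<B>" "B \<subseteq> W" "openin X B"
      using base_of_openin[OF base] by (auto simp: \<B>W_def)
    show "B \<in> \<D>"
    proof (cases "B = {}")
      case False
      then obtain p where p: "p \<in> B" "p \<in> C"
        using dense[OF B(3)] B(2) by blast
      show ?thesis
      proof (cases "B = {p}")
        case True
        then show ?thesis using p by (simp add: \<D>_def)
      next
        case False
        then have "(B - {p}) \<inter> W \<noteq> {}"
          using p(1) B(2) by blast
        then have "(B - {p}) \<inter> C \<noteq> {}"
          by (rule dense[OF openin_Diff_singleton[OF t1 B(3)]])
        then obtain q where "q \<in> B" "q \<in> C - {p}"
          by blast
        then show ?thesis using p B(1) unfolding \<D>_def by blast
      qed
    qed (simp add: \<D>_def)
  qed
  ultimately have "countable \<B>W"
    using countable_subset by blast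
  moreover have "openin (subtopology X W) B" if "B \<in> \<B>W" for B
    using that base_of_openin[OF base] W by (simp add: \<B>W_def openin_open_subtopology)
  moreover have "\<exists>B\<in>\<B>W. x \<in> B \<and> B \<subseteq> U" if "openin (subtopology X W) U" "x \<in> U" for U x
  proof -
    have "openin X U" "U \<subseteq> W"
      using that(1) W by (auto simp: openin_open_subtopology)
    then show ?thesis
      using base_of_refine[OF base _ that(2)] unfolding \<B>W_def by (metis (lifting) mem_Collect_eq subset_trans)
  qed
  ultimately show ?thesis
    unfolding second_countable_def by (intro exI[of _ \<B>W]) simp
qed

section \<open>Separability from the countable chain condition and the Baire property\<close>

lemma maximal_disjoint_subfamily:
  assumes "{} \<notin> \<A>"
  obtains \<P> where "\<P> \<subseteq> \<A>" "pairwise disjnt \<P>" "\<And>A. A \<in> \<A> \<Longrightarrow> \<exists>P\<in>\<P>. \<not> disjnt A P"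
proof -
  define \<Q> where "\<Q> = {\<P>. \<P> \<subseteq> \<A> \<and> pairwise disjnt \<P>}"
  have "\<Union>\<C> \<in> \<Q>" if "subset.chain \<Q> \<C>" for \<C>
  proof -
    have 1: "\<C> \<subseteq> \<Q>" and 2: "\<And>S T. S \<in> \<C> \<Longrightarrow> T \<in> \<C> \<Longrightarrow> S \<subseteq> T \<or> T \<subseteq> S"
      using that by (auto simp: subset_chain_def)
    have "disjnt A A'" if A: "A \<in> \<Union>\<C>" "A' \<in> \<Union>\<C>" "A \<noteq> A'" for A A'
    proof -
      obtain S T where "S \<in> \<C>" "T \<in> \<C>" "A \<in> S" "A' \<in> T"
        using A by blast
      then obtain R where "R \<in> \<C>" "A \<in> R" "A' \<in> R"
        using 2 by blast
      then show ?thesis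
        using 1 A(3) unfolding \<Q>_def pairwise_def by blast
    qed
    then show ?thesis
      using 1 unfolding \<Q>_def pairwise_def by blast
  qed
  then obtain \<P> where P: "\<P> \<in> \<Q>" and max: "\<And>S. S \<in> \<Q> \<Longrightarrow> \<P> \<subseteq> S \<Longrightarrow> S = \<P>"
    using subset_Zorn'[of \<Q>] by blast
  have "\<exists>P\<in>\<P>. \<not> disjnt A P" if "A \<in> \<A>" for A
  proof (rule ccontr)
    assume neg: "\<not> (\<exists>P\<in>\<P>. \<not> disjnt A P)"
    then have "insert A \<P> \<in> \<Q>"
      using P that unfolding \<Q>_def by (auto simp: pairwise_insert disjnt_sym)
    then have "A \<in> \<P>"
      using max by blast
    then have "disjnt A A"
      using neg by blast
    then show False
      using that assms by auto
  qed
  with P show thesis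
    using that unfolding \<Q>_def by blast
qed

text \<open>
  The chain condition and the Baire property of \<open>U\<close> are phrased with open subsets of \<open>X\<close> contained in
  \<open>U\<close>, so that they can be inherited from neighbourhoods of a point that need not be open.
\<close>
lemma separable_if_ccc_Baire_sharp_base:
  assumes t1: "t1_space X" and sb: "sharp_base X \<B>" and U: "openin X U"
    and ccc: "\<And>\<U>. (\<And>V. V \<in> \<U> \<Longrightarrow> openin X V \<and> V \<noteq> {} \<and> V \<subseteq> U) \<Longrightarrow> pairwise disjnt \<U> \<Longrightarrow> countable \<U>"
    and Baire: "\<And>(G :: nat \<Rightarrow> 'a set) V.
        (\<And>n. openin X (G n)) \<Longrightarrow>
        (\<And>n V. openin X V \<Longrightarrow> V \<noteq> {} \<Longrightarrow> V \<subseteq> U \<Longrightarrow> V \<inter> G n \<noteq> {}) \<Longrightarrow>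
        openin X V \<Longrightarrow> V \<noteq> {} \<Longrightarrow> V \<subseteq> U \<Longrightarrow> V \<inter> (\<Inter>n. G n) \<noteq> {}"
  shows "separable_space (subtopology X U)"
proof -
  note base = sharp_base_imp_base_of[OF sb]
  \<comment> \<open>An isolated point may stop the refinement below; these points are put into the dense set
    directly.\<close>
  define I where "I = {x. openin X {x}}"
  define \<A> where "\<A> B = {A \<in> \<B>. A \<noteq> {} \<and> A \<subset> B}" for B
  have "\<exists>\<P>. \<P> \<subseteq> \<A> B \<and> pairwise disjnt \<P> \<and> (\<forall>A\<in>\<A> B. \<exists>P\<in>\<P>. \<not> disjnt A P)" for B
  proof -
    have "{} \<notin> \<A> B"
      by (simp add: \<A>_def)
    then show ?thesis
      using maximal_disjoint_subfamily[of "\<A> B"] by metis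
  qed
  then obtain R where R: "\<And>B. R B \<subseteq> \<A> B" "\<And>B. pairwise disjnt (R B)"
      "\<And>B A. A \<in> \<A> B \<Longrightarrow> \<exists>P\<in>R B. \<not> disjnt A P"
    by metis
  \<comment> \<open>\<open>U\<close> itself need not be a base element, so the sequences handed to the sharp base start at
    level 1.\<close>
  define P where "P = rec_nat {U} (\<lambda>_ \<P>. \<Union>B\<in>\<P>. R B)"
  have P0: "P 0 = {U}" and PSuc: "\<And>n. P (Suc n) = (\<Union>B\<in>P n. R B)"
    by (simp_all add: P_def)
  have Psub: "\<And>B. B \<in> P n \<Longrightarrow> B \<subseteq> U \<and> openin X B" for n
  proof (induction n)
    case (Suc n)
    then show ?case
      using R(1) base_of_openin[OF base] unfolding PSuc \<A>_def by blast
  qed (simp add: P0 U)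
  have Pdisj: "pairwise disjnt (P n)" for n
  proof (induction n)
    case (Suc n)
    show ?case
    proof (rule pairwiseI)
      fix C C' assume "C \<in> P (Suc n)" "C' \<in> P (Suc n)" and "C \<noteq> C'"
      then obtain B B' where B: "B \<in> P n" "C \<in> R B" "B' \<in> P n" "C' \<in> R B'"
        unfolding PSuc by blast
      show "disjnt C C'"
      proof (cases "B = B'")
        case True
        then show ?thesis using B R(2) \<open>C \<noteq> C'\<close> by (metis pairwiseD)
      next
        case False
        then have "disjnt B B'" using Suc B by (metis pairwiseD)
        moreover have "C \<subseteq> B" "C' \<subseteq> B'"
          using B R(1) unfolding \<A>_def by blast+
        ultimately show ?thesis by (meson disjnt_subset1 disjnt_subset2)
      qed
    qed
  qed (simp add: P0)
  have Pdense: "V \<inter> (\<Union>(P n) \<union> I) \<noteq> {}" if V: "openin X V" "V \<noteq> {}" "V \<subseteq> U" for n V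
  proof (cases "V \<inter> I = {}")
    case True
    have "V \<inter> \<Union>(P n) \<noteq> {}"
    proof (induction n)
      case 0
      then show ?case using V P0 by auto
    next
      case (Suc n)
      then obtain B x where B: "B \<in> P n" and x: "x \<in> V \<inter> B"
        by blast
      have op: "openin X (V \<inter> B)"
        using V Psub[OF B] by blast
      have "V \<inter> B \<noteq> {x}"
        using op x True unfolding I_def by auto
      then obtain y where y: "y \<in> V \<inter> B" "y \<noteq> x"
        using x by blast
      then have "x \<in> V \<inter> B - {y}"
        using x by blast
      then obtain A where "A \<in> \<B>" "x \<in> A" "A \<subseteq> V \<inter> B - {y}"
        using base_of_refine[OF base openin_Diff_singleton[OF t1 op]] by metis
      then have A: "A \<in> \<A> B" "A \<subseteq> V"
        using y by (auto simp: \<A>_def)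
      obtain Q where Q: "Q \<in> R B" "\<not> disjnt A Q"
        using R(3)[OF A(1)] by blast
      then have "Q \<in> P (Suc n)" "A \<inter> Q \<noteq> {}"
        using B by (auto simp: PSuc disjnt_def)
      then show ?case
        using A(2) by blast
    qed
    then show ?thesis by blast
  qed blast
  have Iopen: "openin X I"
  proof -
    have "I = \<Union>((\<lambda>x. {x}) ` I)" by blast
    also have "openin X \<dots>" by (rule openin_Union) (auto simp: I_def)
    finally show ?thesis .
  qed
  have Pcount: "countable (P n - {{}})" for n
  proof (rule ccc)
    show "pairwise disjnt (P n - {{}})"
      using Pdisj[of n] by (rule pairwise_subset) auto
  qed (use Psub in auto)
  have "countable ((\<lambda>x. {x}) ` (I \<inter> U))"
    by (rule ccc) (auto simp: I_def pairwise_def)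
  then have Icount: "countable (I \<inter> U)"
    by (rule countable_image_inj_on) simp
  define D where "D = I \<inter> U \<union> (\<Union>n. (\<lambda>B. SOME x. x \<in> B) ` (P n - {{}}))"
  have "countable D"
    unfolding D_def using Icount Pcount by (intro countable_Un countable_UN countable_image) simp_all
  moreover have "D \<subseteq> U"
  proof -
    have "(SOME x. x \<in> B) \<in> U" if "B \<in> P n - {{}}" for B n
    proof -
      have "(SOME x. x \<in> B) \<in> B"
        using that by (simp add: some_in_eq)
      then show ?thesis
        using that Psub[of B n] by blast
    qed
    then show ?thesis by (auto simp: D_def)
  qed
  moreover have "V \<inter> D \<noteq> {}" if V: "openin X V" "V \<inter> U \<noteq> {}" for V
  proof -
    have VU: "openin X (V \<inter> U)" using V U by blast
    have "V \<inter> U \<inter> (\<Inter>n. \<Union>(P n) \<union> I) \<noteq> {}"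
    proof (rule Baire[OF _ _ VU])
      show "openin X (\<Union>(P n) \<union> I)" for n
        using Psub[of _ n] Iopen by (intro openin_Un openin_Union) simp_all
    qed (use V Pdense in simp_all)
    then obtain x where x: "x \<in> V" "x \<in> U" "\<And>n. x \<in> \<Union>(P n) \<union> I"
      by blast
    show ?thesis
    proof (cases "x \<in> I")
      case True
      then show ?thesis using x unfolding D_def by blast
    next
      case False
      then have "\<forall>n. \<exists>B. B \<in> P n \<and> x \<in> B"
        using x(3) by blast
      then obtain B where B: "\<And>n. B n \<in> P n" "\<And>n. x \<in> B n"
        by metis
      \<comment> \<open>Disjointness of level \<open>n\<close> identifies the parent of \<open>B (Suc n)\<close> as \<open>B n\<close>.\<close>
      have BSuc: "B (Suc n) \<in> \<A> (B n)" for n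
      proof -
        obtain B' where B': "B' \<in> P n" "B (Suc n) \<in> R B'"
          using B(1)[of "Suc n"] unfolding PSuc by blast
        then have "x \<in> B'" using R(1) B(2)[of "Suc n"] unfolding \<A>_def by blast
        then have "\<not> disjnt B' (B n)" using B(2) by (auto simp: disjnt_def)
        then have "B' = B n" using Pdisj[of n] B' B(1) by (metis pairwiseD)
        then show ?thesis using B' R(1) by blast
      qed
      have dec: "B n \<subset> B m" if "m < n" for m n
        using that
      proof (induction n)
        case (Suc n)
        moreover have "B (Suc n) \<subset> B n"
          using BSuc unfolding \<A>_def by blast
        ultimately show ?case
          by (metis less_Suc_eq psubset_trans)
      qed simp
      have "inj (\<lambda>n. B (Suc n))"
        by (rule linorder_injI) (use dec in blast)
      moreover have "B (Suc n) \<in> \<B>" for n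
        using BSuc unfolding \<A>_def by blast
      moreover have "x \<in> topspace X"
        using x(2) U openin_subset by blast
      ultimately have "local_base_at X x (range (\<lambda>n. \<Inter>j\<le>n. B (Suc j)))"
        using sb B(2) unfolding sharp_base_def by blast
      then obtain n where n: "(\<Inter>j\<le>n. B (Suc j)) \<subseteq> V \<inter> U"
        using VU x unfolding local_base_at_def by blast
      have "B (Suc n) \<subseteq> B (Suc j)" if "j \<le> n" for j
        using dec[of "Suc j" "Suc n"] that by (cases "j = n") auto
      then have "B (Suc n) \<subseteq> V"
        using n by blast
      moreover have "(SOME y. y \<in> B (Suc n)) \<in> B (Suc n)"
        using B(2) by (meson someI)
      moreover have "(SOME y. y \<in> B (Suc n)) \<in> D"
      proof -
        have "B (Suc n) \<in> P (Suc n) - {{}}"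
          using B by blast
        then show ?thesis
          unfolding D_def by (intro UnI2 UN_I[of "Suc n"] imageI) simp_all
      qed
      ultimately show ?thesis by blast
    qed
  qed
  ultimately show ?thesis
    unfolding separable_subtopology_iff[OF U] by (intro exI[of _ D]) simp
qed

lemma ccc_space_open_subset:
  assumes "ccc_space (subtopology X N)" "U \<subseteq> N"
    and "\<And>V. V \<in> \<U> \<Longrightarrow> openin X V \<and> V \<noteq> {} \<and> V \<subseteq> U" "pairwise disjnt \<U>"
  shows "countable \<U>"
proof -
  have "openin (subtopology X N) V" if "V \<in> \<U>" for V
    using assms(2) assms(3)[OF that] by (metis inf.orderE openin_subtopology subset_trans)
  then show ?thesis
    using assms unfolding ccc_space_def by blast
qed

lemma Baire_space_open_subset:
  fixes G :: "nat \<Rightarrow> 'a set"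
  assumes Baire: "Baire_space (subtopology X N)" and N: "N \<subseteq> topspace X"
    and U: "openin X U" "U \<subseteq> N"
    and G: "\<And>n. openin X (G n)"
    and dense: "\<And>n V. openin X V \<Longrightarrow> V \<noteq> {} \<Longrightarrow> V \<subseteq> U \<Longrightarrow> V \<inter> G n \<noteq> {}"
    and V: "openin X V" "V \<noteq> {}" "V \<subseteq> U"
  shows "V \<inter> (\<Inter>n. G n) \<noteq> {}"
proof -
  let ?Y = "subtopology X N"
  have top: "topspace ?Y = N" using N by auto
  \<comment> \<open>Density is only known inside \<open>U\<close>; adding the exterior of \<open>U\<close> makes the sets dense in \<open>N\<close>.\<close>
  define H where "H n = N \<inter> (G n \<union> (topspace X - X closure_of U))" for n
  have H: "openin ?Y (H n)" for n
    unfolding H_def using G by (intro openin_subtopology_Int2 openin_Un) auto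
  have "?Y closure_of (H n) = N" for n
  proof -
    have "\<exists>y\<in>H n. y \<in> T" if x: "x \<in> N" "openin ?Y T" "x \<in> T" for x T
    proof -
      obtain O' where O': "openin X O'" "T = O' \<inter> N"
        using x(2) by (auto simp: openin_subtopology)
      show ?thesis
      proof (cases "O' \<inter> U = {}")
        case True
        then have "x \<notin> X closure_of U"
          using O' x(3) by (auto simp: in_closure_of)
        then have "x \<in> H n" using x(1) N by (auto simp: H_def)
        then show ?thesis using x(3) by blast
      next
        case False
        then have "O' \<inter> U \<inter> G n \<noteq> {}"
          using dense[of "O' \<inter> U" n] O'(1) U(1) by blast
        then show ?thesis using U(2) O'(2) unfolding H_def by blast
      qed
    qed
    then show ?thesis
      unfolding closure_of_def top by blast
  qed
  then have "?Y closure_of (N \<inter> \<Inter>(range H)) = N"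
    using Baire H unfolding Baire_space_def top by simp
  moreover have opV: "openin ?Y V"
    using V U by (metis inf.orderE openin_subtopology subset_trans)
  moreover obtain x where x: "x \<in> V" using V by blast
  ultimately have "x \<in> ?Y closure_of (N \<inter> \<Inter>(range H))"
    using V(3) U(2) by (metis subsetD)
  then obtain y where "y \<in> V" "y \<in> N \<inter> \<Inter>(range H)"
    using opV x unfolding in_closure_of by metis
  then have y: "y \<in> V" "\<And>n. y \<in> H n"
    by simp_all
  have "y \<in> X closure_of U"
    using y(1) V by (meson U(1) closure_of_subset openin_subset subsetD)
  then show ?thesis
    using y unfolding H_def by blast
qed

section \<open>Induction along chains of closed sets\<close>

unbundle cardinal_syntax

definition closed_under :: "('b \<Rightarrow> 'b \<Rightarrow> 'b set) \<Rightarrow> 'b set \<Rightarrow> bool" where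
  "closed_under c S \<longleftrightarrow> (\<forall>a\<in>S. \<forall>b\<in>S. c a b \<subseteq> S)"

primrec closure_stage :: "('b \<Rightarrow> 'b \<Rightarrow> 'b set) \<Rightarrow> 'b set \<Rightarrow> nat \<Rightarrow> 'b set" where
  "closure_stage c A 0 = A"
| "closure_stage c A (Suc n) = closure_stage c A n \<union>
     (\<Union>(a, b) \<in> closure_stage c A n \<times> closure_stage c A n. c a b)"

lemma closure_stage_mono:
  assumes "A \<subseteq> A'"
  shows "closure_stage c A n \<subseteq> closure_stage c A' n"
proof (induction n)
  case (Suc n)
  then show ?case by auto
qed (simp add: assms)

lemma closed_under_closure: "closed_under c (\<Union>n. closure_stage c A n)"
proof -
  have mono: "closure_stage c A m \<subseteq> closure_stage c A n" if "m \<le> n" for m n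
    using that by (rule lift_Suc_mono_le[rotated]) auto
  have "c a b \<subseteq> (\<Union>n. closure_stage c A n)"
    if "a \<in> closure_stage c A m" "b \<in> closure_stage c A n" for a b m n
  proof -
    have "a \<in> closure_stage c A (max m n)" "b \<in> closure_stage c A (max m n)"
      using that mono[of m "max m n"] mono[of n "max m n"] by auto
    then have "c a b \<subseteq> closure_stage c A (Suc (max m n))"
      by auto
    then show ?thesis by blast
  qed
  then show ?thesis
    unfolding closed_under_def by blast
qed

text \<open>
  Each of the countably many stages adds countably many elements for every pair, which does not
  increase an infinite cardinal.
\<close>
lemma card_of_closure:
  assumes count: "\<And>a b. countable (c a b)" and K: "infinite K" and A: "|A| \<le>o |K|"
  shows "|\<Union>n. closure_stage c A n| \<le>o |K|"
proof -
  have nat: "|X| \<le>o |K|" if "countable X" for X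
  proof -
    have "|X| \<le>o |UNIV :: nat set|"
      using that unfolding countable_def card_of_ordLeq[symmetric] by blast
    also have "|UNIV :: nat set| \<le>o |K|"
      using K infinite_iff_card_of_nat by blast
    finally show ?thesis .
  qed
  have "|closure_stage c A n| \<le>o |K|" for n
  proof (induction n)
    case (Suc n)
    have "|closure_stage c A n \<times> closure_stage c A n| \<le>o |K|"
      using Suc by (intro card_of_Sigma_ordLeq_infinite[OF K]) auto
    then have "|\<Union>(a, b) \<in> closure_stage c A n \<times> closure_stage c A n. c a b| \<le>o |K|"
      by (rule card_of_UNION_ordLeq_infinite[OF K]) (auto intro: nat count)
    with Suc show ?case
      by (simp add: card_of_Un_ordLeq_infinite_Field[OF _ _ _ card_of_Card_order] Field_card_of K)
  qed (simp add: A)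
  moreover have "|UNIV :: nat set| \<le>o |K|"
    by (rule nat) simp
  ultimately show ?thesis
    by (intro card_of_UNION_ordLeq_infinite[OF K]) auto
qed

text \<open>
  Adding \<open>nat\<close> disjointly to \<open>A\<close> treats finite and infinite \<open>A\<close> alike: the sum is infinite and still
  smaller than the uncountable set \<open>S\<close>.
\<close>
lemma small_closure:
  assumes count: "\<And>a b. countable (c a b)" and S: "uncountable S" and A: "|A| <o |S|"
  shows "|\<Union>n. closure_stage c A n| <o |S|"
proof -
  let ?K = "A <+> (UNIV :: nat set)"
  have "|UNIV :: nat set| <o |S|"
    using S by (metis card_of_Well_order card_of_ordLeq countableI not_ordLeq_iff_ordLess)
  moreover have "infinite S"
    using S countable_finite by blast
  ultimately have "|?K| <o |S|"
    using A card_of_Plus_ordLess_infinite by blast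
  moreover have "|\<Union>n. closure_stage c A n| \<le>o |?K|"
    by (rule card_of_closure[OF count _ card_of_Plus1]) simp
  ultimately show ?thesis
    using ordLeq_ordLess_trans by blast
qed

text \<open>
  This is induction on the cardinality of \<open>S\<close>.  A well-order of \<open>S\<close> of minimal type has initial
  segments of smaller cardinality; their closures \<open>E a\<close> are still smaller, so that the property is
  known for all subsets of each \<open>E a\<close>, although the union of the increasing chain \<open>E\<close> covers \<open>S\<close>.
\<close>
lemma induct_closed_chain [case_names operation countable chain]:
  fixes c :: "'b \<Rightarrow> 'b \<Rightarrow> 'b set"
  assumes count: "\<And>a b. countable (c a b)"
    and countable: "\<And>S. countable S \<Longrightarrow> P S"
    and chain: "\<And>S r E. \<lbrakk>well_order_on S r; \<And>a. a \<in> S \<Longrightarrow> a \<in> E a;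
        \<And>a b. (a, b) \<in> r \<Longrightarrow> E a \<subseteq> E b; \<And>a. a \<in> S \<Longrightarrow> closed_under c (E a);
        \<And>a T. \<lbrakk>a \<in> S; T \<subseteq> E a\<rbrakk> \<Longrightarrow> P T\<rbrakk> \<Longrightarrow> P S"
  shows "P S"
proof -
  have "wf (inv_image ordLess (\<lambda>S :: 'b set. |S| ))"
    by (rule wf_inv_image[OF wf_ordLess])
  then show ?thesis
  proof (induction S rule: wf_induct_rule)
    case (less S)
    show ?case
    proof (cases "countable S")
      case False
      define r where "r = |S|"
      have wo: "well_order_on S r"
        unfolding r_def by (rule card_of_well_order_on)
      have Fld: "Field r = S"
        unfolding r_def by (rule Field_card_of)
      have ref: "(a, a) \<in> r" if "a \<in> S" for a
        using wo that unfolding well_order_on_def linear_order_on_def partial_order_on_def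
          preorder_on_def refl_on_def by blast
      have tr: "trans r"
        using wo unfolding well_order_on_def linear_order_on_def partial_order_on_def
          preorder_on_def by blast
      define E where "E a = (\<Union>n. closure_stage c (under r a) n)" for a
      have small: "|E a| <o |S|" if "a \<in> S" for a
      proof -
        have "|underS r a| <o |S|"
          using card_of_underS[OF card_of_Card_order, of a S] that Fld unfolding r_def by simp
        moreover have "|{a}| <o |S|"
          using False by (metis card_of_Well_order card_of_ordLeq_finite countable_finite
              finite.emptyI finite.insertI not_ordLeq_iff_ordLess)
        moreover have "infinite S"
          using False countable_finite by blast
        ultimately have "|underS r a \<union> {a}| <o |S|"
          by (intro card_of_Un_ordLess_infinite)
        moreover have "under r a \<subseteq> underS r a \<union> {a}"
          by (auto simp: under_def underS_def)
        ultimately have "|under r a| <o |S|"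
          using card_of_mono1 ordLeq_ordLess_trans by blast
        then show ?thesis
          unfolding E_def by (rule small_closure[OF count False])
      qed
      show ?thesis
      proof (rule chain[OF wo])
        show "a \<in> E a" if "a \<in> S" for a
        proof -
          have "a \<in> closure_stage c (under r a) 0"
            using ref[OF that] by (simp add: under_def)
          then show ?thesis unfolding E_def by blast
        qed
        show "E a \<subseteq> E b" if "(a, b) \<in> r" for a b
        proof -
          have "under r a \<subseteq> under r b"
            using tr that by (auto simp: under_def dest: transD)
          then show ?thesis
            unfolding E_def by (intro UN_mono closure_stage_mono) simp_all
        qed
        show "closed_under c (E a)" for a
          unfolding E_def by (rule closed_under_closure)
        show "P T" if "a \<in> S" "T \<subseteq> E a" for a T
        proof (rule less)
          have "|T| <o |S|"
            using small[OF that(1)] that(2) card_of_mono1 ordLeq_ordLess_trans by blast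
          then show "(T, S) \<in> inv_image ordLess (\<lambda>S. |S| )"
            by simp
        qed
      qed
    qed (rule countable)
  qed
qed

unbundle no cardinal_syntax

section \<open>Point-countable shrinkings\<close>

text \<open>
  If \<open>B\<close> met the union of the closed family \<open>\<T>\<close> in two points, then by T1 two distinct nearby points
  of the dense sets of members of \<open>\<T>\<close> would lie in \<open>B\<close>, which puts \<open>B\<close> into \<open>\<T>\<close>.
\<close>
lemma trace_on_closed_family:
  assumes t1: "t1_space X"
    and op: "\<And>B. B \<in> \<F> \<Longrightarrow> openin X B"
    and D: "\<And>B. B \<in> \<F> \<Longrightarrow> D B \<subseteq> B"
    and dense: "\<And>B V. B \<in> \<F> \<Longrightarrow> openin X V \<Longrightarrow> V \<inter> B \<noteq> {} \<Longrightarrow> V \<inter> D B \<noteq> {}"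
    and closed: "\<And>A A' B p q. \<lbrakk>A \<in> \<T>; A' \<in> \<T>; B \<in> \<F>; p \<in> D A \<inter> B; q \<in> D A' \<inter> B; p \<noteq> q\<rbrakk> \<Longrightarrow> B \<in> \<T>"
    and \<T>: "\<T> \<subseteq> \<F>" and B: "B \<in> \<F>" "B \<notin> \<T>"
  shows "\<exists>p. B \<inter> \<Union>\<T> \<subseteq> {p}"
proof -
  have "x = y" if x: "x \<in> B \<inter> \<Union>\<T>" and y: "y \<in> B \<inter> \<Union>\<T>" for x y
  proof (rule ccontr)
    assume "x \<noteq> y"
    obtain A where A: "A \<in> \<T>" "x \<in> A"
      using x by blast
    obtain A' where A': "A' \<in> \<T>" "y \<in> A'"
      using y by blast
    have "openin X (B \<inter> A - {y})"
      using A(1) \<T> B(1) op by (intro openin_Diff_singleton[OF t1]) blast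
    moreover have "x \<in> (B \<inter> A - {y}) \<inter> A"
      using x A(2) \<open>x \<noteq> y\<close> by blast
    ultimately have "(B \<inter> A - {y}) \<inter> D A \<noteq> {}"
      using A(1) \<T> by (intro dense) auto
    then obtain p where p: "p \<in> D A \<inter> B" "p \<noteq> y"
      by blast
    have "openin X (B \<inter> A' - {p})"
      using A'(1) \<T> B(1) op by (intro openin_Diff_singleton[OF t1]) blast
    moreover have "y \<in> (B \<inter> A' - {p}) \<inter> A'"
      using y A'(2) p(2) by blast
    ultimately have "(B \<inter> A' - {p}) \<inter> D A' \<noteq> {}"
      using A'(1) \<T> by (intro dense) auto
    then obtain q where q: "q \<in> D A' \<inter> B" "p \<noteq> q"
      by blast
    have "B \<in> \<T>"
      by (rule closed[OF A(1) A'(1) B(1) p(1) q])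
    then show False
      using B(2) by blast
  qed
  then have "B \<inter> \<Union>\<T> = {} \<or> (\<exists>p. B \<inter> \<Union>\<T> = {p})"
    by blast
  then show ?thesis
    by (metis empty_subsetI order_refl)
qed

text \<open>
  Every set of \<open>\<F>\<close> belongs to a first stage \<open>m B\<close> of the chain of closed families.  The new set \<open>g B\<close>
  comes from the shrinking available for that stage, minus the union \<open>\<Union>(\<T> (m B))\<close> of all sets of
  earlier stages.  A point then lies in sets \<open>g B\<close> of one stage only.
\<close>
lemma shrink_to_point_countable:
  assumes t1: "t1_space X"
    and sep: "\<And>B. B \<in> \<F> \<Longrightarrow> openin X B \<and> separable_space (subtopology X B)"
    and two: "\<And>p q. p \<in> topspace X \<Longrightarrow> p \<noteq> q \<Longrightarrow> countable {B \<in> \<F>. p \<in> B \<and> q \<in> B}"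
  shows "\<exists>g. (\<forall>B\<in>\<F>. openin X (g B) \<and> g B \<subseteq> B \<and> (\<forall>x\<in>B - g B. openin X {x})) \<and>
    (\<forall>x. countable {B \<in> \<F>. x \<in> g B})"
proof -
  have op: "\<And>B. B \<in> \<F> \<Longrightarrow> openin X B"
    using sep by blast
  have "\<forall>B\<in>\<F>. \<exists>C. countable C \<and> C \<subseteq> B \<and> (\<forall>V. openin X V \<and> V \<inter> B \<noteq> {} \<longrightarrow> V \<inter> C \<noteq> {})"
    using sep separable_subtopology_iff by blast
  then obtain D where "\<forall>B\<in>\<F>. countable (D B) \<and> D B \<subseteq> B \<and>
      (\<forall>V. openin X V \<and> V \<inter> B \<noteq> {} \<longrightarrow> V \<inter> D B \<noteq> {})"
    by (rule bchoice[THEN exE])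
  then have Dc: "\<And>B. B \<in> \<F> \<Longrightarrow> countable (D B)" and Dsub: "\<And>B. B \<in> \<F> \<Longrightarrow> D B \<subseteq> B"
    and dense: "\<And>B V. B \<in> \<F> \<Longrightarrow> openin X V \<Longrightarrow> V \<inter> B \<noteq> {} \<Longrightarrow> V \<inter> D B \<noteq> {}"
    by simp_all
  \<comment> \<open>The guard makes \<open>c\<close> countable also at arguments where \<open>D\<close> is arbitrary.\<close>
  define c where "c A A' = (if A \<in> \<F> \<and> A' \<in> \<F>
      then \<Union>p\<in>D A. \<Union>q\<in>D A' - {p}. {B \<in> \<F>. p \<in> B \<and> q \<in> B} else {})" for A A'
  have c_count: "countable (c A A')" for A A'
  proof (cases "A \<in> \<F> \<and> A' \<in> \<F>")
    case True
    have "countable {B \<in> \<F>. p \<in> B \<and> q \<in> B}" if "p \<in> D A" "q \<in> D A' - {p}" for p q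
    proof (rule two)
      show "p \<in> topspace X"
        using that(1) True Dsub openin_subset[OF op] by blast
    qed (use that in auto)
    then have "countable (\<Union>p\<in>D A. \<Union>q\<in>D A' - {p}. {B \<in> \<F>. p \<in> B \<and> q \<in> B})"
      using True Dc by (intro countable_UN countable_Diff) auto
    then show ?thesis
      using True by (simp add: c_def)
  qed (auto simp: c_def)
  define shrinkable where "shrinkable \<S> \<longleftrightarrow> (\<exists>g.
      (\<forall>B\<in>\<S>. openin X (g B) \<and> g B \<subseteq> B \<and> (\<forall>x\<in>B - g B. openin X {x})) \<and>
      (\<forall>x. countable {B \<in> \<S>. x \<in> g B}))" for \<S>
  have "\<S> \<subseteq> \<F> \<longrightarrow> shrinkable \<S>" for \<S>
  proof (induction \<S> rule: induct_closed_chain[where c = c])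
    case (operation A A')
    show ?case by (rule c_count)
  next
    case (countable \<S>)
    show ?case
      unfolding shrinkable_def
      using op countable by (intro impI exI[of _ "\<lambda>B. B"]) auto
  next
    case (chain \<S> r E)
    show ?case
    proof
      assume S: "\<S> \<subseteq> \<F>"
      have wo: "well_order_on \<S> r" by fact
      have lin: "total_on \<S> r" "r \<subseteq> \<S> \<times> \<S>" "wf (r - Id)"
        using wo unfolding well_order_on_def linear_order_on_def partial_order_on_def
          preorder_on_def by simp_all
      have tot: "(a, b) \<in> r \<or> (b, a) \<in> r \<or> a = b" if "a \<in> \<S>" "b \<in> \<S>" for a b
        using lin(1) that unfolding total_on_def by blast
      have rS: "a \<in> \<S> \<and> b \<in> \<S>" if "(a, b) \<in> r" for a b
        using lin(2) that by blast
      have "\<exists>a. a \<in> \<S> \<and> B \<in> E a \<and> (\<forall>b. (b, a) \<in> r - Id \<longrightarrow> B \<notin> E b)"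
        if "B \<in> \<S>" for B
      proof -
        let ?Q = "{a \<in> \<S>. B \<in> E a}"
        have "B \<in> ?Q"
          using that chain(2) by simp
        then have "\<exists>a\<in>?Q. \<forall>b. (b, a) \<in> r - Id \<longrightarrow> b \<notin> ?Q"
          using lin(3) unfolding wf_eq_minimal by meson
        then obtain a where a: "a \<in> ?Q" "\<And>b. (b, a) \<in> r - Id \<Longrightarrow> b \<notin> ?Q"
          by meson
        moreover have "B \<notin> E b" if "(b, a) \<in> r - Id" for b
          using a(2)[OF that] rS[of b a] that by simp
        ultimately show ?thesis
          by auto
      qed
      then obtain m where m: "\<And>B. B \<in> \<S> \<Longrightarrow> m B \<in> \<S>" "\<And>B. B \<in> \<S> \<Longrightarrow> B \<in> E (m B)"
        "\<And>B b. B \<in> \<S> \<Longrightarrow> (b, m B) \<in> r - Id \<Longrightarrow> B \<notin> E b"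
        by metis
      have "\<forall>a. \<exists>g. a \<in> \<S> \<longrightarrow>
          (\<forall>B\<in>\<S> \<inter> E a. openin X (g B) \<and> g B \<subseteq> B \<and> (\<forall>x\<in>B - g B. openin X {x})) \<and>
          (\<forall>x. countable {B \<in> \<S> \<inter> E a. x \<in> g B})"
      proof
        fix a
        have "shrinkable (\<S> \<inter> E a)" if "a \<in> \<S>"
          using chain(5)[OF that, of "\<S> \<inter> E a"] S by auto
        then show "\<exists>g. a \<in> \<S> \<longrightarrow>
            (\<forall>B\<in>\<S> \<inter> E a. openin X (g B) \<and> g B \<subseteq> B \<and> (\<forall>x\<in>B - g B. openin X {x})) \<and>
            (\<forall>x. countable {B \<in> \<S> \<inter> E a. x \<in> g B})"
          unfolding shrinkable_def by (cases "a \<in> \<S>") simp_all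
      qed
      then obtain G where G: "\<forall>a. a \<in> \<S> \<longrightarrow>
          (\<forall>B\<in>\<S> \<inter> E a. openin X (G a B) \<and> G a B \<subseteq> B \<and> (\<forall>x\<in>B - G a B. openin X {x})) \<and>
          (\<forall>x. countable {B \<in> \<S> \<inter> E a. x \<in> G a B})"
        by (rule choice[THEN exE])
      define \<T> where "\<T> a = {B \<in> \<F>. \<exists>b. (b, a) \<in> r - Id \<and> B \<in> E b}" for a
      define g where "g B = G (m B) B - \<Union>(\<T> (m B))" for B
      \<comment> \<open>The earlier stages form a chain of closed families, hence their union is closed as well.\<close>
      have trace: "\<exists>p. B \<inter> \<Union>(\<T> (m B)) \<subseteq> {p}" if B: "B \<in> \<S>" for B
      proof -
        have closed: "A'' \<in> \<T> (m B)"
          if A: "A \<in> \<T> (m B)" "A' \<in> \<T> (m B)" "A'' \<in> \<F>" "p \<in> D A \<inter> A''" "q \<in> D A' \<inter> A''" "p \<noteq> q"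
          for A A' A'' p q
        proof -
          obtain b b' where b: "(b, m B) \<in> r - Id" "A \<in> E b" "(b', m B) \<in> r - Id" "A' \<in> E b'"
            using A(1,2) unfolding \<T>_def by blast
          then have "b \<in> \<S>" "b' \<in> \<S>"
            using rS by blast+
          then have "E b \<subseteq> E b' \<or> E b' \<subseteq> E b"
            using tot chain(3) by blast
          then obtain d where d: "(d, m B) \<in> r - Id" "A \<in> E d" "A' \<in> E d"
            using b by blast
          then have "c A A' \<subseteq> E d"
            using chain(4)[of d] rS unfolding closed_under_def by blast
          moreover have "A'' \<in> c A A'"
            using A unfolding c_def \<T>_def by auto
          ultimately show ?thesis
            using A(3) d(1) unfolding \<T>_def by blast
        qed
        show ?thesis
        proof (rule trace_on_closed_family[of X \<F> D, OF t1])
          show "B \<notin> \<T> (m B)"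
            using m(3)[OF B] unfolding \<T>_def by blast
          show "\<T> (m B) \<subseteq> \<F>" "B \<in> \<F>"
            using S B unfolding \<T>_def by auto
        qed (fact op Dsub dense closed)+
      qed
      have g: "openin X (g B) \<and> g B \<subseteq> B \<and> (\<forall>x\<in>B - g B. openin X {x})" if B: "B \<in> \<S>" for B
      proof -
        have GB: "openin X (G (m B) B)" "G (m B) B \<subseteq> B" "\<And>x. x \<in> B - G (m B) B \<Longrightarrow> openin X {x}"
          using G m(1,2)[OF B] B by auto
        obtain p where p: "B \<inter> \<Union>(\<T> (m B)) \<subseteq> {p}"
          by (rule exE[OF trace[OF B]])
        \<comment> \<open>A removed point is isolated because its singleton is this open intersection.\<close>
        have opT: "openin X (B \<inter> \<Union>(\<T> (m B)))"
          using op S B unfolding \<T>_def by (intro openin_Int openin_Union) auto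
        have "g B = G (m B) B - B \<inter> \<Union>(\<T> (m B))"
          using GB(2) by (auto simp: g_def)
        then have "g B = G (m B) B \<or> g B = G (m B) B - {p}"
          using subset_singletonD[OF p] by auto
        then have "openin X (g B)"
          using GB(1) openin_Diff_singleton[OF t1] by metis
        moreover have "openin X {x}" if x: "x \<in> B - g B" for x
        proof (cases "x \<in> \<Union>(\<T> (m B))")
          case True
          then have "x \<in> B \<inter> \<Union>(\<T> (m B))"
            using x by blast
          then have "B \<inter> \<Union>(\<T> (m B)) = {x}"
            using subset_singletonD[OF p] by (metis empty_iff singletonD)
          then show ?thesis using opT by metis
        next
          case False
          then show ?thesis
            using x by (intro GB(3)) (simp add: g_def)
        qed
        moreover have "g B \<subseteq> B"
          using GB(2) by (auto simp: g_def)
        ultimately show ?thesis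
          by simp
      qed
      have "countable {B \<in> \<S>. x \<in> g B}" for x
      proof (cases "\<exists>A\<in>\<S>. x \<in> g A")
        case True
        then obtain A where A: "A \<in> \<S>" "x \<in> g A"
          by blast
        have same_stage: "(m B, m B') \<notin> r - Id" if "B \<in> \<S>" "x \<in> g B" "B' \<in> \<S>" "x \<in> g B'" for B B'
        proof
          assume "(m B, m B') \<in> r - Id"
          then have "B \<in> \<T> (m B')"
            using m(2) that S unfolding \<T>_def by blast
          moreover have "x \<in> B"
            using g that by blast
          ultimately show False
            using that(4) unfolding g_def by blast
        qed
        have "m B = m A" if "B \<in> \<S>" "x \<in> g B" for B
          using tot[OF m(1) m(1), OF that(1) A(1)] same_stage[OF that A] same_stage[OF A that] by blast
        then have "{B \<in> \<S>. x \<in> g B} \<subseteq> {B \<in> \<S> \<inter> E (m A). x \<in> G (m A) B}"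
          using m(2) unfolding g_def by auto
        moreover have "countable {B \<in> \<S> \<inter> E (m A). x \<in> G (m A) B}"
          using G m(1)[OF A(1)] by blast
        ultimately show ?thesis
          by (rule countable_subset)
      next
        case False
        then have "{B \<in> \<S>. x \<in> g B} = {}"
          by blast
        then show ?thesis
          by (simp only: countable_empty)
      qed
      with g show "shrinkable \<S>"
        unfolding shrinkable_def by (intro exI[of _ g]) simp
    qed
  qed
  then have "shrinkable \<F>"
    by simp
  then show ?thesis
    unfolding shrinkable_def .
qed

text \<open>
  An open separable set meets only countably many members of the cover, because each of those
  contains a point of its countable dense subset.  The equivalence classes of the transitive
  closure of overlapping are therefore countable, and their unions are the pieces.
\<close>
lemma partition_of_point_countable_cover:
  assumes cover: "\<Union>\<O> = topspace X"
    and sep: "\<And>V. V \<in> \<O> \<Longrightarrow> openin X V \<and> separable_space (subtopology X V)"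
    and pc: "\<And>x. countable {V \<in> \<O>. x \<in> V}"
  shows "\<exists>\<W>. \<Union>\<W> = topspace X \<and> pairwise disjnt \<W> \<and>
    (\<forall>W\<in>\<W>. openin X W \<and> separable_space (subtopology X W))"
proof -
  define r where "r = {(A, B). A \<in> \<O> \<and> B \<in> \<O> \<and> A \<inter> B \<noteq> {}}"
  have "countable (r `` {A})" for A
  proof (cases "A \<in> \<O>")
    case True
    obtain C where C: "countable C" "\<And>V. openin X V \<Longrightarrow> V \<inter> A \<noteq> {} \<Longrightarrow> V \<inter> C \<noteq> {}"
      using sep[OF True] separable_subtopology_iff[of X A] by metis
    have "r `` {A} \<subseteq> (\<Union>x\<in>C. {B \<in> \<O>. x \<in> B})"
    proof
      fix B assume "B \<in> r `` {A}"
      then have B: "B \<in> \<O>" "B \<inter> A \<noteq> {}"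
        by (auto simp: r_def)
      then have "B \<inter> C \<noteq> {}"
        using C(2) sep by blast
      then show "B \<in> (\<Union>x\<in>C. {B \<in> \<O>. x \<in> B})"
        using B(1) by blast
    qed
    moreover have "countable (\<Union>x\<in>C. {B \<in> \<O>. x \<in> B})"
      using C(1) pc by (intro countable_UN)
    ultimately show ?thesis
      by (rule countable_subset)
  qed (simp add: r_def)
  then have "countable (r `` Y)" if "countable Y" for Y
    using that by (metis Image_eq_UN countable_UN)
  then have star_count: "countable (r\<^sup>* `` {A})" for A
    by (intro countable_rtrancl) auto
  have star_O: "r\<^sup>* `` {A} \<subseteq> \<O>" if "A \<in> \<O>" for A
  proof -
    have "B \<in> \<O>" if "(A, B) \<in> r\<^sup>*" for B
      using that \<open>A \<in> \<O>\<close> by (induction rule: rtrancl_induct) (auto simp: r_def)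
    then show ?thesis by blast
  qed
  have "sym r"
    by (auto simp: r_def sym_def)
  then have star_sym: "(A, B) \<in> r\<^sup>* \<Longrightarrow> (B, A) \<in> r\<^sup>*" for A B
    by (meson sym_rtrancl symD)
  define \<W> where "\<W> = (\<lambda>A. \<Union>(r\<^sup>* `` {A})) ` \<O>"
  show ?thesis
  proof (intro exI[of _ \<W>] conjI ballI)
    show "\<Union>\<W> = topspace X"
    proof
      show "\<Union>\<W> \<subseteq> topspace X"
        using star_O cover unfolding \<W>_def by blast
      show "topspace X \<subseteq> \<Union>\<W>"
        using cover unfolding \<W>_def by blast
    qed
    show "pairwise disjnt \<W>"
    proof (rule pairwiseI)
      fix W W' assume W: "W \<in> \<W>" "W' \<in> \<W>" and "W \<noteq> W'"
      obtain A A' where A: "A \<in> \<O>" "W = \<Union>(r\<^sup>* `` {A})" "A' \<in> \<O>" "W' = \<Union>(r\<^sup>* `` {A'})"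
        using W unfolding \<W>_def by blast
      show "disjnt W W'"
      proof (rule ccontr)
        assume "\<not> disjnt W W'"
        then obtain x B B' where B: "(A, B) \<in> r\<^sup>*" "x \<in> B" "(A', B') \<in> r\<^sup>*" "x \<in> B'"
          unfolding disjnt_def A by blast
        then have "(B, B') \<in> r"
          using star_O A unfolding r_def by blast
        then have "(A, A') \<in> r\<^sup>*"
          using B star_sym by (meson rtrancl.rtrancl_into_rtrancl rtrancl_trans)
        then have "r\<^sup>* `` {A} = r\<^sup>* `` {A'}"
          using star_sym by (blast intro: rtrancl_trans)
        then show False
          using \<open>W \<noteq> W'\<close> A by simp
      qed
    qed
    fix W assume W: "W \<in> \<W>"
    have "openin X W \<and> separable_space (subtopology X W)"
    proof -
      obtain A where A: "A \<in> \<O>" "W = \<Union>(r\<^sup>* `` {A})"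
        using W unfolding \<W>_def by blast
      have opsep: "openin X B \<and> separable_space (subtopology X B)" if "B \<in> r\<^sup>* `` {A}" for B
        using that star_O[OF A(1)] sep by blast
      have "openin X W"
        unfolding A(2) using opsep by (intro openin_Union) blast
      then show ?thesis
        using separable_subtopology_Union[OF star_count opsep] A(2) by simp
    qed
    then show "openin X W" "separable_space (subtopology X W)"
      by simp_all
  qed
qed

section \<open>Metrization theorems\<close>

text \<open>
  A continuous map into a product is an embedding as soon as its coordinate functions separate
  points from closed sets: T1 gives injectivity, and preimages under single coordinates witness
  openness onto the image.
\<close>
lemma embedding_map_into_product:
  assumes t1: "t1_space X"
    and cont: "\<And>k. k \<in> K \<Longrightarrow> continuous_map X (Y k) (f k)"
    and sep: "\<And>x U. openin X U \<Longrightarrow> x \<in> U \<Longrightarrow>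
        \<exists>k\<in>K. \<exists>V. openin (Y k) V \<and> f k x \<in> V \<and> (\<forall>y\<in>topspace X. f k y \<in> V \<longrightarrow> y \<in> U)"
  shows "embedding_map X (product_topology Y K) (\<lambda>x. \<lambda>k\<in>K. f k x)"
proof -
  define e where "e = (\<lambda>x. \<lambda>k\<in>K. f k x)"
  let ?P = "product_topology Y K"
  have cont_e: "continuous_map X ?P e"
    unfolding e_def by (rule continuous_map_componentwise[THEN iffD2]) (use cont in auto)
  have "inj_on e (topspace X)"
  proof (rule inj_onI, rule ccontr)
    fix x y assume x: "x \<in> topspace X" and y: "y \<in> topspace X" and eq: "e x = e y" and "x \<noteq> y"
    have "openin X (topspace X - {y})"
      by (rule openin_Diff_singleton[OF t1 openin_topspace])
    moreover have "x \<in> topspace X - {y}"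
      using x \<open>x \<noteq> y\<close> by simp
    ultimately obtain k V where k: "k \<in> K" "f k x \<in> V" "\<forall>z\<in>topspace X. f k z \<in> V \<longrightarrow> z \<in> topspace X - {y}"
      using sep by meson
    have "f k x = f k y"
      using fun_cong[OF eq, of k] k(1) by (simp add: e_def)
    then show False
      using k y by auto
  qed
  moreover have "open_map X (subtopology ?P (e ` topspace X)) e"
    unfolding open_map_def
  proof (intro allI impI)
    fix U assume U: "openin X U"
    define \<O> where "\<O> = {V'. openin ?P V' \<and> e ` topspace X \<inter> V' \<subseteq> e ` U}"
    have "e ` U = e ` topspace X \<inter> \<Union>\<O>"
    proof
      show "e ` topspace X \<inter> \<Union>\<O> \<subseteq> e ` U"
        unfolding \<O>_def by blast
      show "e ` U \<subseteq> e ` topspace X \<inter> \<Union>\<O>"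
      proof
        fix z assume "z \<in> e ` U"
        then obtain x where x: "x \<in> U" "z = e x" by blast
        have xX: "x \<in> topspace X"
          using x(1) U openin_subset by blast
        obtain k V where k: "k \<in> K" "openin (Y k) V" "f k x \<in> V"
            "\<forall>y\<in>topspace X. f k y \<in> V \<longrightarrow> y \<in> U"
          using sep[OF U x(1)] by blast
        define V' where "V' = {w \<in> topspace ?P. w k \<in> V}"
        have "openin ?P V'"
          unfolding V'_def
          using k(2) by (intro openin_continuous_map_preimage[of ?P "Y k" "\<lambda>w. w k"])
            (simp_all add: k(1) continuous_map_product_projection)
        moreover have "e ` topspace X \<inter> V' \<subseteq> e ` U"
          using k unfolding V'_def e_def by auto
        moreover have "e x \<in> V'"
        proof -
          have "e x \<in> topspace ?P"
            using continuous_map_image_subset_topspace[OF cont_e] xX by blast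
          moreover have "e x k \<in> V"
            using k(1,3) by (simp add: e_def)
          ultimately show ?thesis
            by (simp add: V'_def)
        qed
        ultimately show "z \<in> e ` topspace X \<inter> \<Union>\<O>"
          using xX x(2) unfolding \<O>_def by blast
      qed
    qed
    moreover have "openin ?P (\<Union>\<O>)"
      unfolding \<O>_def by blast
    ultimately show "openin (subtopology ?P (e ` topspace X)) (e ` U)"
      by (metis openin_subtopology_Int2)
  qed
  ultimately have "homeomorphic_map X (subtopology ?P (e ` topspace X)) e"
    using cont_e continuous_map_image_subset_topspace[OF cont_e]
    by (intro bijective_open_imp_homeomorphic_map) (auto simp: continuous_map_in_subtopology)
  then show ?thesis
    unfolding embedding_map_def e_def .
qed

text \<open>
  Regularity yields, for every point of a base element \<open>B\<close>, a base element \<open>A\<close> around it with closure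
  inside \<open>B\<close>.  Urysohn functions for the countably many such pairs embed the space into a countable
  power of the real line.
\<close>
theorem Urysohn_metrization:
  assumes t1: "t1_space X" and reg: "regular_space X" and sc: "second_countable X"
  shows "metrizable_space X"
proof -
  have norm: "normal_space X"
    using reg sc regular_Lindelof_imp_normal_space second_countable_imp_Lindelof_space by blast
  obtain \<B> where \<B>: "countable \<B>" "\<And>B. B \<in> \<B> \<Longrightarrow> openin X B"
    "\<And>U x. openin X U \<Longrightarrow> x \<in> U \<Longrightarrow> \<exists>B\<in>\<B>. x \<in> B \<and> B \<subseteq> U"
    using sc unfolding second_countable_def by metis
  define K where "K = {(A, B). A \<in> \<B> \<and> B \<in> \<B> \<and> X closure_of A \<subseteq> B}"
  have "\<exists>f. continuous_map X euclideanreal f \<and> f ` (X closure_of A) \<subseteq> {0} \<and> f ` (topspace X - B) \<subseteq> {1}"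
    if "(A, B) \<in> K" for A B
  proof -
    have "closedin X (X closure_of A)" "closedin X (topspace X - B)" "disjnt (X closure_of A) (topspace X - B)"
      using that \<B>(2) unfolding K_def disjnt_def by auto
    then show ?thesis
      using Urysohn_lemma_alt[OF norm] by metis
  qed
  then have "\<forall>k. \<exists>f. k \<in> K \<longrightarrow> continuous_map X euclideanreal f \<and>
      f ` (X closure_of fst k) \<subseteq> {0} \<and> f ` (topspace X - snd k) \<subseteq> {1}"
    by (metis prod.collapse)
  then obtain f where f: "\<forall>k. k \<in> K \<longrightarrow> continuous_map X euclideanreal (f k) \<and>
      f k ` (X closure_of fst k) \<subseteq> {0} \<and> f k ` (topspace X - snd k) \<subseteq> {1}"
    by (rule choice[THEN exE])
  have "embedding_map X (product_topology (\<lambda>_. euclideanreal) K) (\<lambda>x. \<lambda>k\<in>K. f k x)"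
  proof (rule embedding_map_into_product[OF t1])
    show "continuous_map X euclideanreal (f k)" if "k \<in> K" for k
      using f that by blast
    show "\<exists>k\<in>K. \<exists>V. openin euclideanreal V \<and> f k x \<in> V \<and> (\<forall>y\<in>topspace X. f k y \<in> V \<longrightarrow> y \<in> U)"
      if U: "openin X U" "x \<in> U" for x U
    proof -
      obtain B where B: "B \<in> \<B>" "x \<in> B" "B \<subseteq> U"
        using \<B>(3)[OF U] by blast
      have "neighbourhood_base_of (closedin X) X"
        using reg by (simp add: neighbourhood_base_of_closedin)
      then obtain W C where "openin X W" "closedin X C" "x \<in> W" "W \<subseteq> C" "C \<subseteq> B"
        using \<B>(2)[OF B(1)] B(2) unfolding neighbourhood_base_of by metis
      moreover obtain A where "A \<in> \<B>" "x \<in> A" "A \<subseteq> W"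
        using \<B>(3) calculation(1,3) by metis
      ultimately have A: "A \<in> \<B>" "x \<in> A" "X closure_of A \<subseteq> B"
        using closure_of_minimal[of A C X] by auto
      then have k: "(A, B) \<in> K"
        using B(1) by (simp add: K_def)
      have "x \<in> X closure_of A"
        using A(2) \<B>(2)[OF A(1)] by (meson closure_of_subset openin_subset subsetD)
      then have "f (A, B) x = 0"
        using f k by auto
      moreover have "y \<in> U" if "y \<in> topspace X" "f (A, B) y < 1" for y
      proof (rule ccontr)
        assume "y \<notin> U"
        then have "y \<in> topspace X - snd (A, B)"
          using that(1) B(3) by auto
        then have "f (A, B) y = 1"
          using f k by blast
        then show False
          using that(2) by simp
      qed
      ultimately show ?thesis
        using k by (intro bexI[of _ "(A, B)"] exI[of _ "{..<1}"]) auto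
    qed
  qed
  then have "X homeomorphic_space
      subtopology (product_topology (\<lambda>_. euclideanreal) K) ((\<lambda>x. \<lambda>k\<in>K. f k x) ` topspace X)"
    by (rule embedding_map_imp_homeomorphic_space)
  moreover have "countable K"
  proof (rule countable_subset)
    show "K \<subseteq> \<B> \<times> \<B>"
      by (auto simp: K_def)
  qed (use \<B>(1) in simp)
  then have "metrizable_space (product_topology (\<lambda>_. euclideanreal) K)"
    unfolding metrizable_space_product_topology using metrizable_space_euclidean by auto
  ultimately show ?thesis
    using metrizable_space_subtopology homeomorphic_metrizable_space by blast
qed

text \<open>
  Distances inside a piece are capped at 1 and points of different pieces get distance 1; small
  balls of the resulting metric are balls of the pieces.
\<close>
lemma metrizable_disjoint_union:
  assumes cover: "\<Union>\<W> = topspace X" and disj: "pairwise disjnt \<W>"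
    and met: "\<And>W. W \<in> \<W> \<Longrightarrow> openin X W \<and> metrizable_space (subtopology X W)"
  shows "metrizable_space X"
proof -
  have "\<forall>W. \<exists>d. W \<in> \<W> \<longrightarrow> Metric_space W d \<and> subtopology X W = Metric_space.mtopology W d"
  proof (intro allI)
    fix W
    show "\<exists>d. W \<in> \<W> \<longrightarrow> Metric_space W d \<and> subtopology X W = Metric_space.mtopology W d"
    proof (cases "W \<in> \<W>")
      case True
      then obtain M d where M: "Metric_space M d" "subtopology X W = Metric_space.mtopology M d"
        using met unfolding metrizable_space_def by blast
      have "topspace (subtopology X W) = W"
        using True cover by auto
      then have "M = W"
        using M by (simp add: Metric_space.topspace_mtopology)
      then show ?thesis
        using M by blast
    qed simp
  qed
  then obtain d where d: "\<forall>W. W \<in> \<W> \<longrightarrow> Metric_space W (d W) \<and> subtopology X W = Metric_space.mtopology W (d W)"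
    by (rule choice[THEN exE])
  define M where "M = topspace X"
  have "\<forall>x. \<exists>W. x \<in> M \<longrightarrow> W \<in> \<W> \<and> x \<in> W"
    using cover M_def by blast
  then obtain w where w: "\<And>x. x \<in> M \<Longrightarrow> w x \<in> \<W>" "\<And>x. x \<in> M \<Longrightarrow> x \<in> w x"
    by metis
  have w_eq: "w x = W" if "W \<in> \<W>" "x \<in> W" for x W
  proof -
    have "x \<in> M" using that cover M_def by blast
    then show ?thesis
      using w[of x] that disj unfolding pairwise_def disjnt_def by blast
  qed
  \<comment> \<open>Points outside \<open>M\<close> get distance 1, since a metric must be nonnegative and symmetric everywhere.\<close>
  define D where
    "D x y = (if x \<in> M \<and> y \<in> M \<and> w x = w y then min 1 (d (w x) x y) else 1)" for x y
  have met_w: "Metric_space (w x) (d (w x))" if "x \<in> M" for x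
    using d w(1)[OF that] by blast
  interpret D: Metric_space M D
  proof
    show "0 \<le> D x y" for x y
      using Metric_space.nonneg[OF met_w] by (simp add: D_def)
    show "D x y = D y x" for x y
      using Metric_space.commute[OF met_w] by (simp add: D_def)
    show "D x y = 0 \<longleftrightarrow> x = y" if "x \<in> M" "y \<in> M" for x y
    proof (cases "w x = w y")
      case True
      then have "d (w x) x y = 0 \<longleftrightarrow> x = y"
        using Metric_space.zero[OF met_w[OF that(1)], of x y] w(2) that by metis
      then show ?thesis
        using True that by (auto simp: D_def min_def)
    qed (use that in \<open>auto simp: D_def\<close>)
    show "D x z \<le> D x y + D y z" if "x \<in> M" "y \<in> M" "z \<in> M" for x y z
    proof (cases "w x = w y \<and> w y = w z")
      case True
      then have "d (w x) x z \<le> d (w x) x y + d (w x) y z"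
        using Metric_space.triangle[OF met_w[OF that(1)], of x y z] w(2) that by metis
      moreover have "0 \<le> d (w x) x y" "0 \<le> d (w x) y z"
        using Metric_space.nonneg[OF met_w[OF that(1)]] by auto
      ultimately show ?thesis
        using True that by (auto simp: D_def min_def)
    next
      case False
      have "0 \<le> D x y" "0 \<le> D y z" "D x z \<le> 1"
        using Metric_space.nonneg[OF met_w] by (simp_all add: D_def)
      moreover have "D x y = 1 \<or> D y z = 1"
        using False by (auto simp: D_def)
      ultimately show ?thesis by linarith
    qed
  qed
  have "openin D.mtopology U \<longleftrightarrow> openin X U" for U
  proof
    assume U: "openin X U"
    then have UM: "U \<subseteq> M"
      unfolding M_def by (rule openin_subset)
    have "\<exists>r>0. D.mball x r \<subseteq> U" if x: "x \<in> U" for x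
    proof -
      have xM: "x \<in> M" using x UM by blast
      interpret W: Metric_space "w x" "d (w x)" by (rule met_w[OF xM])
      have "openin W.mtopology (U \<inter> w x)"
        using d w(1)[OF xM] U by (metis openin_subtopology_Int)
      moreover have "x \<in> U \<inter> w x"
        using x w(2)[OF xM] by blast
      ultimately obtain r where r: "r > 0" "W.mball x r \<subseteq> U \<inter> w x"
        unfolding W.openin_mtopology by blast
      have "y \<in> W.mball x r" if y: "y \<in> D.mball x (min r 1)" for y
      proof -
        have "y \<in> M" "w x = w y" "d (w x) x y < r"
          using y xM by (auto simp: D_def split: if_splits)
        then show ?thesis
          using w(2) xM by (metis W.in_mball)
      qed
      then have "D.mball x (min r 1) \<subseteq> U"
        using r(2) by blast
      then show ?thesis
        using r(1) by (intro exI[of _ "min r 1"]) auto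
    qed
    then show "openin D.mtopology U"
      unfolding D.openin_mtopology using UM by blast
  next
    assume U: "openin D.mtopology U"
    then have UM: "U \<subseteq> M"
      unfolding D.openin_mtopology by blast
    have "openin X (U \<inter> W)" if W: "W \<in> \<W>" for W
    proof -
      interpret W: Metric_space W "d W" using d W by blast
      have "\<exists>r>0. W.mball x r \<subseteq> U \<inter> W" if x: "x \<in> U \<inter> W" for x
      proof -
        obtain r where r: "r > 0" "D.mball x r \<subseteq> U"
          using U x unfolding D.openin_mtopology by blast
        have "y \<in> D.mball x r" if y: "y \<in> W.mball x r" for y
        proof -
          have yW: "y \<in> W" "d W x y < r"
            using y by auto
          moreover have "x \<in> M" "y \<in> M"
            using x yW(1) W cover unfolding M_def by blast+
          moreover have "w x = W" "w y = W"
            using w_eq[OF W] x yW(1) by auto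
          ultimately show ?thesis
            by (simp add: D_def)
        qed
        then show ?thesis
          using r by (intro exI[of _ r]) auto
      qed
      then have "openin W.mtopology (U \<inter> W)"
        unfolding W.openin_mtopology by blast
      then have "openin (subtopology X W) (U \<inter> W)"
        using d W by simp
      then show ?thesis
        using met[OF W] openin_open_subtopology by blast
    qed
    then have "openin X (\<Union>W\<in>\<W>. U \<inter> W)"
      by blast
    moreover have "(\<Union>W\<in>\<W>. U \<inter> W) = U"
      using UM cover unfolding M_def by blast
    ultimately show "openin X U"
      by simp
  qed
  then have "X = D.mtopology"
    by (simp add: topology_eq)
  then show ?thesis
    using D.metrizable_space_mtopology by simp
qed

section \<open>Metrizability of spaces with a sharp base\<close>

text \<open>
  Near every point the intersection of a CCC and a Baire neighbourhood supplies a separable base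
  element.  The family of all these is shrunk to a point-countable one, which splits the space into
  disjoint open pieces that are second countable.
\<close>
theorem theorem5:
  fixes X :: "'a topology"
  assumes "t1_space X" and "regular_space X"
    and "locally_space ccc_space X"
    and "locally_space Baire_space X"
    and "\<exists>\<B>. sharp_base X \<B>"
  shows "metrizable_space X"
proof -
  note t1 = assms(1)
  obtain \<B> where sb: "sharp_base X \<B>"
    using assms(5) by blast
  note base = sharp_base_imp_base_of[OF sb]
  define \<F> where "\<F> = {B \<in> \<B>. separable_space (subtopology X B)}"
  have sep: "openin X B \<and> separable_space (subtopology X B)" if "B \<in> \<F>" for B
    using that base_of_openin[OF base] by (simp add: \<F>_def)
  have \<F>_cover: "\<exists>B\<in>\<F>. x \<in> B" if x: "x \<in> topspace X" for x
  proof -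
    obtain U1 N1 where 1: "openin X U1" "x \<in> U1" "U1 \<subseteq> N1" "ccc_space (subtopology X N1)"
      using assms(3) x unfolding locally_space_def by meson
    obtain U2 N2 where 2: "openin X U2" "x \<in> U2" "U2 \<subseteq> N2" "N2 \<subseteq> topspace X"
        "Baire_space (subtopology X N2)"
      using assms(4) x unfolding locally_space_def by meson
    define U where "U = U1 \<inter> U2"
    have U: "openin X U" "x \<in> U" "U \<subseteq> N1" "U \<subseteq> N2"
      using 1 2 by (auto simp: U_def)
    have "separable_space (subtopology X U)"
    proof (rule separable_if_ccc_Baire_sharp_base[OF t1 sb U(1)])
      show "countable \<U>"
        if "\<And>V. V \<in> \<U> \<Longrightarrow> openin X V \<and> V \<noteq> {} \<and> V \<subseteq> U" "pairwise disjnt \<U>" for \<U>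
        using ccc_space_open_subset[OF 1(4) U(3) that] by simp
      show "V \<inter> (\<Inter>n. G n) \<noteq> {}"
        if "\<And>n. openin X (G n)"
          "\<And>n V. openin X V \<Longrightarrow> V \<noteq> {} \<Longrightarrow> V \<subseteq> U \<Longrightarrow> V \<inter> G n \<noteq> {}"
          "openin X V" "V \<noteq> {}" "V \<subseteq> U" for G :: "nat \<Rightarrow> 'a set" and V
        using Baire_space_open_subset[OF 2(5,4) U(1,4), of G V] that by simp
    qed
    moreover obtain B where B: "B \<in> \<B>" "x \<in> B" "B \<subseteq> U"
      by (rule base_of_refine[OF base U(1,2)])
    ultimately have "B \<in> \<F>"
      using separable_subtopology_subset base_of_openin[OF base] unfolding \<F>_def by blast
    then show ?thesis
      using B(2) by blast
  qed
  have two: "countable {B \<in> \<F>. p \<in> B \<and> q \<in> B}" if "p \<in> topspace X" "p \<noteq> q" for p q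
  proof (rule countable_subset)
    show "{B \<in> \<F>. p \<in> B \<and> q \<in> B} \<subseteq> {B \<in> \<B>. p \<in> B \<and> q \<in> B}"
      by (auto simp: \<F>_def)
    show "countable {B \<in> \<B>. p \<in> B \<and> q \<in> B}"
      by (rule countable_finite[OF sharp_base_finite_two_points[OF t1 sb that]])
  qed
  have "\<exists>g. (\<forall>B\<in>\<F>. openin X (g B) \<and> g B \<subseteq> B \<and> (\<forall>x\<in>B - g B. openin X {x})) \<and>
      (\<forall>x. countable {B \<in> \<F>. x \<in> g B})"
    by (rule shrink_to_point_countable[OF t1]) (fact sep two)+
  then obtain g where "\<forall>B\<in>\<F>. openin X (g B) \<and> g B \<subseteq> B \<and> (\<forall>x\<in>B - g B. openin X {x})"
      "\<forall>x. countable {B \<in> \<F>. x \<in> g B}"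
    by (elim exE conjE)
  then have g: "\<And>B. B \<in> \<F> \<Longrightarrow> openin X (g B) \<and> g B \<subseteq> B"
    "\<And>B x. B \<in> \<F> \<Longrightarrow> x \<in> B - g B \<Longrightarrow> openin X {x}"
    "\<And>x. countable {B \<in> \<F>. x \<in> g B}"
    by simp_all
  \<comment> \<open>The points lost in the shrinking are isolated; their singletons restore the covering.\<close>
  define \<O> where "\<O> = g ` \<F> \<union> {{x} | x. openin X {x}}"
  have \<O>_cover: "\<Union>\<O> = topspace X"
  proof
    show "\<Union>\<O> \<subseteq> topspace X"
      using g(1) openin_subset unfolding \<O>_def by blast
    show "topspace X \<subseteq> \<Union>\<O>"
    proof
      fix x assume "x \<in> topspace X"
      then obtain B where B: "B \<in> \<F>" "x \<in> B"
        using \<F>_cover by blast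
      then have "x \<in> g B \<or> openin X {x}"
        using g(2) by blast
      then show "x \<in> \<Union>\<O>"
        using B(1) unfolding \<O>_def by blast
    qed
  qed
  have \<O>_sep: "openin X V \<and> separable_space (subtopology X V)" if V: "V \<in> \<O>" for V
  proof -
    consider B where "B \<in> \<F>" "V = g B" | x where "openin X {x}" "V = {x}"
      using V unfolding \<O>_def by blast
    then show ?thesis
    proof cases
      case 1
      then show ?thesis
        using g(1) sep separable_subtopology_subset by metis
    next
      case 2
      have "separable_space (subtopology X {x})"
        unfolding separable_subtopology_iff[OF 2(1)] by (intro exI[of _ "{x}"]) simp
      with 2 show ?thesis
        by simp
    qed
  qed
  have \<O>_countable: "countable {V \<in> \<O>. x \<in> V}" for x
  proof (rule countable_subset)
    show "{V \<in> \<O>. x \<in> V} \<subseteq> insert {x} (g ` {B \<in> \<F>. x \<in> g B})"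
      unfolding \<O>_def by auto
  qed (use g(3) in simp)
  have "\<exists>\<W>. \<Union>\<W> = topspace X \<and> pairwise disjnt \<W> \<and>
      (\<forall>W\<in>\<W>. openin X W \<and> separable_space (subtopology X W))"
    by (rule partition_of_point_countable_cover[OF \<O>_cover]) (fact \<O>_sep \<O>_countable)+
  then obtain \<W> where \<W>: "\<Union>\<W> = topspace X" "pairwise disjnt \<W>"
    and sepW: "\<forall>W\<in>\<W>. openin X W \<and> separable_space (subtopology X W)"
    by (elim exE conjE)
  show ?thesis
  proof (rule metrizable_disjoint_union[OF \<W>])
    fix W assume "W \<in> \<W>"
    then have W: "openin X W" "separable_space (subtopology X W)"
      using sepW by auto
    moreover have "second_countable (subtopology X W)"
      by (rule separable_imp_second_countable_sharp_base[OF t1 sb W])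
    ultimately show "openin X W \<and> metrizable_space (subtopology X W)"
      using Urysohn_metrization t1_space_subtopology[OF t1] regular_space_subtopology[OF assms(2)]
      by blast
  qed
qed

end
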